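(* Let $p,q>1$ and $a\ge 1$. Then $\arcsin_{p,q}$ is $(a,a)$-convex on $(0,1)$, $\arctan_{p,q}$ is $(a,a)$-concave on $(0,1)$, and $\mathrm{arsinh}_{p,q}$ is $(a,a)$-concave on $(0,\infty)$. In other words, $$\arcsin_{p,q}(M_a(r,s))\le M_a(\arcsin_{p,q}(r),\arcsin_{p,q}(s))\quad\text{for all } r,s\in(0,1),$$ $$\arctan_{p,q}(M_a(r,s))\ge M_a(\arctan_{p,q}(r),\arctan_{p,q}(s))\quad\text{for all } r,s\in(0,1),$$ $$\mathrm{arsinh}_{p,q}(M_a(r,s))\ge M_a(\mathrm{arsinh}_{p,q}(r),\mathrm{arsinh}_{p,q}(s))\quad\text{for all } r,s>0.$$
   Context: Power means: for $a\in\mathbb{R}$ and $x,y>0$, $M_a(x,y)=\left(\frac{x^a+y^a}{2}\right)^{1/a}$ if $a\ne0$, and $M_0(x,y)=\sqrt{xy}$. For an interval $I\subset(0,\infty)$, a continuous function $f:I\to(0,\infty)$ and $a,b\in\mathbb{R}$, $f$ is called $(a,b)$-convex (respectively $(a,b)$-concave) on $I$ if $f(M_a(x,y))\le M_b(f(x),f(y))$ (respectively $\ge$) for all $x,y\in I$. Generalized functions: for $p,q>1$, $\arcsin_{p,q}(x)=\int_0^x(1-t^q)^{-1/p}\,dt$ for $x\in(0,1)$ and $\mathrm{arsinh}_{p,q}(x)=\int_0^x(1+t^q)^{-1/p}\,dt$ for $x\in(0,\infty)$. Put $\pi_{p,q}/2=\arcsin_{p,q}(1)=\int_0^1(1-t^q)^{-1/p}\,dt$.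 The function $\sin_{p,q}:(0,\pi_{p,q}/2)\to(0,1)$ is the inverse of $\arcsin_{p,q}$; $\arccos_{p,q}(x)=\arcsin_{p,q}((1-x^p)^{1/q})$ for $x\in(0,1)$, and $\cos_{p,q}:(0,\pi_{p,q}/2)\to(0,1)$ is the inverse of $\arccos_{p,q}$. The function $\tan_{p,q}:(0,\pi_{p,q}/2)\to(0,\infty)$ is $\tan_{p,q}(x)=\sin_{p,q}(x)/\cos_{p,q}(x)$, and $\arctan_{p,q}$ is its inverse. *)

theory Defs
  imports "HOL-Analysis.Analysis"
begin

definition power_mean :: "real \<Rightarrow> real \<Rightarrow> real \<Rightarrow> real" where
  "power_mean a x y =
     (if a = 0 then sqrt (x * y) else ((x powr a + y powr a) / 2) powr (1 / a))"

(* Functions I \<rightarrow> (0,\<infinity>) are total functions on the reals, so the conditions on I,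
   continuity and positivity on I are part of the notion. *)
definition mean_domain :: "real set \<Rightarrow> (real \<Rightarrow> real) \<Rightarrow> bool" where
  "mean_domain I f \<longleftrightarrow>
     is_interval I \<and> I \<subseteq> {0<..} \<and> continuous_on I f \<and> f ` I \<subseteq> {0<..}"

definition mean_convex_on :: "real \<Rightarrow> real \<Rightarrow> real set \<Rightarrow> (real \<Rightarrow> real) \<Rightarrow> bool" where
  "mean_convex_on a b I f \<longleftrightarrow> mean_domain I f \<and>
     (\<forall>x\<in>I. \<forall>y\<in>I. f (power_mean a x y) \<le> power_mean b (f x) (f y))"

definition mean_concave_on :: "real \<Rightarrow> real \<Rightarrow> real set \<Rightarrow> (real \<Rightarrow> real) \<Rightarrow> bool" where
  "mean_concave_on a b I f \<longleftrightarrow> mean_domain I f \<and>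
     (\<forall>x\<in>I. \<forall>y\<in>I. f (power_mean a x y) \<ge> power_mean b (f x) (f y))"

(* For x = 1 the integrand is unbounded but integrable, since p > 1; at t = 1 itself
   it takes the value 0 powr (- (1 / p)) = 0, which does not affect the integral. *)
definition arcsin_pq :: "real \<Rightarrow> real \<Rightarrow> real \<Rightarrow> real" where
  "arcsin_pq p q x = integral {0..x} (\<lambda>t. (1 - t powr q) powr (- (1 / p)))"

definition arsinh_pq :: "real \<Rightarrow> real \<Rightarrow> real \<Rightarrow> real" where
  "arsinh_pq p q x = integral {0..x} (\<lambda>t. (1 + t powr q) powr (- (1 / p)))"

definition pi_pq :: "real \<Rightarrow> real \<Rightarrow> real" where
  "pi_pq p q = 2 * arcsin_pq p q 1"

(* Inverses are taken on the stated open domains; outside the respective images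
   ((0, pi_pq p q / 2) for sin_pq and cos_pq, (0,\<infinity>) for arctan_pq) the values are
   unspecified. *)
definition sin_pq :: "real \<Rightarrow> real \<Rightarrow> real \<Rightarrow> real" where
  "sin_pq p q = the_inv_into {0<..<1} (arcsin_pq p q)"

definition arccos_pq :: "real \<Rightarrow> real \<Rightarrow> real \<Rightarrow> real" where
  "arccos_pq p q x = arcsin_pq p q ((1 - x powr p) powr (1 / q))"

definition cos_pq :: "real \<Rightarrow> real \<Rightarrow> real \<Rightarrow> real" where
  "cos_pq p q = the_inv_into {0<..<1} (arccos_pq p q)"

definition tan_pq :: "real \<Rightarrow> real \<Rightarrow> real \<Rightarrow> real" where
  "tan_pq p q x = sin_pq p q x / cos_pq p q x"

definition arctan_pq :: "real \<Rightarrow> real \<Rightarrow> real \<Rightarrow> real" where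
  "arctan_pq p q = the_inv_into {0<..<pi_pq p q / 2} (tan_pq p q)"

end

(* For f > 0 put h = f^a and k(x) = x^a. Then h'/k' = (f(x)/x)^(a-1) f'(x), so by Cauchy's mean
   value theorem h is midpoint convex (concave) as a function of k as soon as f(x)/x and f' are
   both increasing (decreasing). For a convex f with f(0) = 0, or a concave f >= 0, the
   monotonicity of f(x)/x follows from that of f'. The derivatives of arcsin_pq and arsinh_pq are
   explicit; with s = sin_pq(y) the derivative of tan_pq at y is 1 + (q/p) s^q / (1 - s^q), which
   increases in s, so that arctan_pq has a decreasing derivative. *)
theory Submission
  imports Defs
begin

section \<open>Convexity with respect to power means\<close>

lemma power_mean_commute: "power_mean a x y = power_mean a y x"
  by (simp add: power_mean_def algebra_simps)

lemma power_mean_same: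
  assumes "a \<noteq> 0" "x > 0"
  shows "power_mean a x x = x"
  using assms by (simp add: power_mean_def powr_powr)

lemma power_mean_powr:
  assumes "a \<noteq> 0" "x > 0" "y > 0"
  shows "power_mean a x y powr a = (x powr a + y powr a) / 2"
proof -
  have "(x powr a + y powr a) / 2 > 0"
    using assms by (simp add: add_pos_pos)
  then show ?thesis
    using assms by (simp add: power_mean_def powr_powr)
qed

lemma power_mean_pos:
  assumes "a \<noteq> 0" "x > 0" "y > 0"
  shows "power_mean a x y > 0"
proof -
  have "x powr a + y powr a > 0"
    using assms by (simp add: add_pos_pos)
  then show ?thesis
    using assms by (simp add: power_mean_def)
qed

lemma powr_le_cancel_base:
  fixes a x y :: real
  assumes "x powr a \<le> y powr a" "a > 0" "y \<ge> 0"
  shows "x \<le> y"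
  using assms by (meson not_le powr_less_mono2)

lemma powr_less_cancel_base:
  fixes a x y :: real
  assumes "x powr a < y powr a" "a > 0" "x \<ge> 0" "y \<ge> 0"
  shows "x < y"
  using assms by (meson not_le powr_mono2 less_imp_le)

lemma power_mean_between:
  assumes "a > 0" "0 < x" "x < y"
  shows "x < power_mean a x y" "power_mean a x y < y"
proof -
  have lt: "x powr a < y powr a"
    using assms by (intro powr_less_mono2) auto
  have m: "power_mean a x y powr a = (x powr a + y powr a) / 2" "power_mean a x y > 0"
    using assms power_mean_powr power_mean_pos by auto
  show "x < power_mean a x y"
    by (rule powr_less_cancel_base[of _ a]) (use m lt assms in auto)
  show "power_mean a x y < y"
    by (rule powr_less_cancel_base[of _ a]) (use m lt assms in auto)
qed

text \<open>Cauchy's mean value theorem on [x, m] and on [m, y] writes each increment of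
  \<open>h\<close> as the increment of \<open>k\<close> times a value of \<open>r\<close>, at some c
  < m and some d > m respectively. By \<open>mid\<close> the two increments of \<open>k\<close>
  agree, and they are positive, so r c <= r d orders the increments of \<open>h\<close>. Stating the
  derivative of \<open>h\<close> as a product with \<open>k'\<close> makes \<open>r\<close> the
  quotient of the derivatives.\<close>

lemma midpoint_le_of_mono_derivative_ratio:
  fixes h k r k' :: "real \<Rightarrow> real"
  assumes "x < m" "m < y"
    and h: "\<And>z. z \<in> {x..y} \<Longrightarrow> (h has_real_derivative r z * k' z) (at z)"
    and k: "\<And>z. z \<in> {x..y} \<Longrightarrow> (k has_real_derivative k' z) (at z)"
    and k': "\<And>z. z \<in> {x..y} \<Longrightarrow> k' z > 0"
    and r: "mono_on {x..y} r"
    and mid: "2 * k m = k x + k y"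
  shows "2 * h m \<le> h x + h y"
proof -
  have *: "\<exists>c. u < c \<and> c < v \<and> h v - h u = (k v - k u) * r c \<and> k v > k u"
    if "x \<le> u" "u < v" "v \<le> y" for u v
  proof -
    have "\<exists>c. u < c \<and> c < v \<and> (h v - h u) * k' c = (k v - k u) * (r c * k' c)"
      using that by (intro GMVT' DERIV_isCont[OF h] DERIV_isCont[OF k] h k) auto
    then obtain c where c: "u < c" "c < v" "(h v - h u) * k' c = (k v - k u) * r c * k' c"
      by (auto simp: mult.assoc)
    have "k' c \<noteq> 0"
      using k'[of c] that c by auto
    then have "h v - h u = (k v - k u) * r c"
      using c(3) by simp
    moreover have "k u < k v"
    proof (rule DERIV_pos_imp_increasing[OF \<open>u < v\<close>])
      fix z assume "u \<le> z" "z \<le> v"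
      then have "z \<in> {x..y}"
        using that by simp
      then show "\<exists>l. (k has_real_derivative l) (at z) \<and> 0 < l"
        using k k' by blast
    qed
    ultimately show ?thesis
      using c by blast
  qed
  obtain c where c: "x < c" "c < m" "h m - h x = (k m - k x) * r c" "k m > k x"
    using *[of x m] assms by auto
  obtain d where d: "m < d" "d < y" "h y - h m = (k y - k m) * r d"
    using *[of m y] assms by auto
  have "r c \<le> r d"
    using r c d by (auto intro!: mono_onD[OF r])
  then have "(k m - k x) * r c \<le> (k m - k x) * r d"
    using c(4) by (intro mult_left_mono) auto
  moreover have "k y - k m = k m - k x"
    using mid by simp
  ultimately have "h m - h x \<le> h y - h m"
    using c(3) d(3) by (simp only:)
  then show ?thesis
    by simp
qed

section \<open>Criteria for differentiable functions on an interval\<close>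

locale mean_setting =
  fixes a :: real and S :: "real set" and f f' :: "real \<Rightarrow> real"
  assumes a: "a \<ge> 1"
    and S: "is_interval S" "S \<subseteq> {0<..}"
    and deriv: "\<And>x. x \<in> S \<Longrightarrow> (f has_real_derivative f' x) (at x)"
    and pos: "\<And>x. x \<in> S \<Longrightarrow> f x > 0"
    and f'_nonneg: "\<And>x. x \<in> S \<Longrightarrow> f' x \<ge> 0"
begin

lemma mean_domain: "mean_domain S f"
  unfolding mean_domain_def using S pos deriv
  by (auto intro!: continuous_at_imp_continuous_on DERIV_isCont)

text \<open>The quotient of the derivatives of f^a and z^a, after cancelling the common factor a. It
  takes the part of \<open>r\<close> in the midpoint comparison.\<close>

abbreviation ratio :: "real \<Rightarrow> real" where
  "ratio z \<equiv> (f z / z) powr (a - 1) * f' z"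

lemma deriv_powr:
  assumes "z \<in> S"
  shows "((\<lambda>z. f z powr a) has_real_derivative ratio z * (a * z powr (a - 1))) (at z)"
proof -
  have "z > 0"
    using S assms by auto
  have "((\<lambda>z. f z powr a) has_real_derivative a * f z powr (a - 1) * f' z) (at z)"
    using DERIV_chain2[OF has_real_derivative_powr[OF pos[OF assms]] deriv[OF assms]] .
  then show ?thesis
    using \<open>z > 0\<close> pos[OF assms] by (simp add: powr_divide field_simps)
qed

text \<open>The a-th power of \<open>m\<close> is the arithmetic mean of x^a and y^a, so the
  midpoint comparison applies with h = f^a and k = z^a. The bounds stay at the level of a-th powers;
  roots are taken only in \<open>mean_convex\<close> and \<open>mean_concave\<close>.\<close>

lemma power_mean_midpoint:
  assumes "x \<in> S" "y \<in> S" "x < y"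
  defines "m \<equiv> power_mean a x y"
  shows "m \<in> S"
    and "mono_on S ratio \<Longrightarrow> f m powr a \<le> (f x powr a + f y powr a) / 2"
    and "antimono_on S ratio \<Longrightarrow> f m powr a \<ge> (f x powr a + f y powr a) / 2"
proof -
  have xy: "0 < x" "0 < y" "{x..y} \<subseteq> S"
    using assms(1,2) S(2) mem_is_interval_1_I[OF S(1) assms(1,2)] by auto
  have m: "x < m" "m < y"
    using power_mean_between[of a x y] a xy assms(3) by (auto simp: m_def)
  then show "m \<in> S"
    using xy by auto
  have k: "((\<lambda>z. z powr a) has_real_derivative a * z powr (a - 1)) (at z)" "a * z powr (a - 1) > 0"
    if "z \<in> {x..y}" for z
    using that xy a by (auto intro!: has_real_derivative_powr)
  have mid: "2 * m powr a = x powr a + y powr a"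
    using power_mean_powr[of a x y] a xy by (simp add: m_def)
  show "f m powr a \<le> (f x powr a + f y powr a) / 2" if "mono_on S ratio"
  proof -
    have "2 * f m powr a \<le> f x powr a + f y powr a"
      by (rule midpoint_le_of_mono_derivative_ratio
          [where r = ratio, OF m deriv_powr k mono_on_subset[OF that xy(3)] mid])
        (use xy in auto)
    then show ?thesis by simp
  qed
  show "f m powr a \<ge> (f x powr a + f y powr a) / 2" if anti: "antimono_on S ratio"
  proof -
    \<comment> \<open>The antitone case is the monotone one for -f^a, whose derivative quotient is
      the negated \<open>ratio\<close>.\<close>
    have "mono_on {x..y} (\<lambda>z. - ratio z)"
      using monotone_on_subset[OF anti xy(3)] by (auto simp: monotone_on_def)
    moreover have "((\<lambda>z. - (f z powr a)) has_real_derivative - ratio z * (a * z powr (a - 1))) (at z)"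
      if "z \<in> {x..y}" for z
      using DERIV_minus[OF deriv_powr[of z]] that xy by auto
    ultimately have "2 * - (f m powr a) \<le> - (f x powr a) + - (f y powr a)"
      by (intro midpoint_le_of_mono_derivative_ratio
          [where r = "\<lambda>z. - ratio z", OF m _ k _ mid]) auto
    then show ?thesis by simp
  qed
qed

lemma mean_convex:
  assumes "mono_on S (\<lambda>z. f z / z)" "mono_on S f'"
  shows "mean_convex_on a a S f"
proof -
  have mono: "mono_on S ratio"
  proof (rule mono_onI)
    fix u v assume uv: "u \<in> S" "v \<in> S" "u \<le> v"
    then have "0 < u" "0 < v" using S by auto
    \<comment> \<open>Both factors are nonnegative and increasing: the power because a - 1 >= 0, the
      other by assumption on \<open>f'\<close>. Nonnegativity of \<open>f'\<close> is what allows
      multiplying the two inequalities.\<close>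
    then show "ratio u \<le> ratio v"
      using uv pos f'_nonneg a mono_onD[OF assms(1) uv] mono_onD[OF assms(2) uv]
      by (intro mult_mono powr_mono2) (auto simp: less_imp_le)
  qed
  have *: "f (power_mean a x y) \<le> power_mean a (f x) (f y)" if "x \<in> S" "y \<in> S" "x < y" for x y
  proof (rule powr_le_cancel_base)
    have fxy: "f x > 0" "f y > 0"
      using pos that by auto
    show "f (power_mean a x y) powr a \<le> power_mean a (f x) (f y) powr a"
      using power_mean_midpoint(2)[OF that mono] power_mean_powr[of a "f x" "f y"] fxy a by simp
    show "power_mean a (f x) (f y) \<ge> 0"
      using power_mean_pos[of a "f x" "f y"] pos[OF power_mean_midpoint(1)[OF that]] fxy a by simp
  qed (use a in simp)
  \<comment> \<open>The midpoint comparison requires two distinct ordered points. Symmetry of the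
    mean covers x > y, and for x = y both sides equal f x.\<close>
  have "f (power_mean a x y) \<le> power_mean a (f x) (f y)" if "x \<in> S" "y \<in> S" for x y
  proof (cases x y rule: linorder_cases)
    case equal
    then show ?thesis
      using that pos[of x] S(2) a power_mean_same[of a x] power_mean_same[of a "f x"] by auto
  qed (use that *[of x y] *[of y x] power_mean_commute[of a] in auto)
  then show ?thesis
    using mean_domain by (simp add: mean_convex_on_def)
qed

lemma mean_concave:
  assumes "antimono_on S (\<lambda>z. f z / z)" "antimono_on S f'"
  shows "mean_concave_on a a S f"
proof -
  have anti: "antimono_on S ratio"
  proof (rule monotone_onI)
    fix u v assume uv: "u \<in> S" "v \<in> S" "u \<le> v"
    then have "0 < u" "0 < v" using S by auto
    then show "ratio v \<le> ratio u"
      using uv pos f'_nonneg a monotone_onD[OF assms(1) uv] monotone_onD[OF assms(2) uv]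
      by (intro mult_mono powr_mono2) (auto simp: less_imp_le)
  qed
  have *: "f (power_mean a x y) \<ge> power_mean a (f x) (f y)" if "x \<in> S" "y \<in> S" "x < y" for x y
  proof (rule powr_le_cancel_base)
    have fxy: "f x > 0" "f y > 0"
      using pos that by auto
    show "power_mean a (f x) (f y) powr a \<le> f (power_mean a x y) powr a"
      using power_mean_midpoint(3)[OF that anti] power_mean_powr[of a "f x" "f y"] fxy a by simp
    show "f (power_mean a x y) \<ge> 0"
      using power_mean_pos[of a "f x" "f y"] pos[OF power_mean_midpoint(1)[OF that]] fxy a by simp
  qed (use a in simp)
  have "f (power_mean a x y) \<ge> power_mean a (f x) (f y)" if "x \<in> S" "y \<in> S" for x y
  proof (cases x y rule: linorder_cases)
    case equal
    then show ?thesis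
      using that pos[of x] S(2) a power_mean_same[of a x] power_mean_same[of a "f x"] by auto
  qed (use that *[of x y] *[of y x] power_mean_commute[of a] in auto)
  then show ?thesis
    using mean_domain by (simp add: mean_concave_on_def)
qed

lemma deriv_divide_self:
  assumes "z \<in> S"
  shows "((\<lambda>z. f z / z) has_real_derivative (z * f' z - f z) / z\<^sup>2) (at z)"
proof -
  have "z > 0"
    using S assms by auto
  then show ?thesis
    using DERIV_divide[OF deriv[OF assms] DERIV_ident]
    by (simp add: power2_eq_square mult.commute)
qed

text \<open>The tangent inequality is the sign condition on the derivative of f(z)/z, so it yields
  the first hypothesis of \<open>mean_convex\<close>. It stays an assumption because it depends on f
  near 0: for f(x) = 1 + x the derivative is monotone but the inequality fails.\<close>

lemma mean_convexI:
  assumes "\<And>x. x \<in> S \<Longrightarrow> f x \<le> x * f' x" "mono_on S f'"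
  shows "mean_convex_on a a S f"
proof (rule mean_convex[OF _ assms(2)], rule mono_onI)
  fix x y assume xy: "x \<in> S" "y \<in> S" "x \<le> y"
  have "\<exists>l. ((\<lambda>z. f z / z) has_real_derivative l) (at z) \<and> 0 \<le> l" if "x \<le> z" "z \<le> y" for z
    using mem_is_interval_1_I[OF S(1) xy(1,2) that] assms(1)[of z]
    by (intro exI[of _ "(z * f' z - f z) / z\<^sup>2"] conjI deriv_divide_self) auto
  then show "f x / x \<le> f y / y"
    using DERIV_nonneg_imp_nondecreasing[OF xy(3)] by blast
qed

text \<open>In the concave case the reversed tangent inequality can be derived: positivity of f
  gives f x > f x - f e, the mean value theorem bounds this difference below by (x - e) f' x, and e
  tends to 0. The hypothesis \<open>down\<close> keeps all these points e in
  \<open>S\<close>.\<close>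

lemma mean_concaveI:
  assumes down: "\<And>x y. y \<in> S \<Longrightarrow> 0 < x \<Longrightarrow> x < y \<Longrightarrow> x \<in> S" and anti: "antimono_on S f'"
  shows "mean_concave_on a a S f"
proof (rule mean_concave[OF _ anti], rule monotone_onI)
  have le: "x * f' x \<le> f x" if x: "x \<in> S" for x
  proof -
    have "x > 0"
      using S x by auto
    \<comment> \<open>\<open>f\<close> need not extend continuously to 0, so the tangent bound is taken on \<open>[e, x]\<close> first.\<close>
    have "(x - e) * f' x \<le> f x" if e: "0 < e" "e < x" for e
    proof -
      have "\<exists>z. e < z \<and> z < x \<and> f x - f e = (x - e) * f' z"
        using e down[OF x] x by (intro MVT2 deriv) (auto simp: le_less)
      then obtain z where z: "e < z" "z < x" "f x - f e = (x - e) * f' z"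
        by blast
      have zS: "z \<in> S"
        using z e down[OF x] by auto
      then have "(x - e) * f' x \<le> (x - e) * f' z"
        using z e x monotone_onD[OF anti zS x] by (intro mult_left_mono) auto
      moreover have "f e > 0"
        using pos down[OF x] e by auto
      ultimately show ?thesis
        using z(3) by linarith
    qed
    then have "\<forall>\<^sub>F e in at_right 0. (x - e) * f' x \<le> f x"
      unfolding eventually_at_right_field using \<open>x > 0\<close> by auto
    moreover have "((\<lambda>e. (x - e) * f' x) \<longlongrightarrow> (x - 0) * f' x) (at_right 0)"
      by (intro tendsto_intros)
    ultimately show ?thesis
      using tendsto_upperbound[of _ "(x - 0) * f' x" "at_right (0::real)" "f x"] by simp
  qed
  fix x y assume xy: "x \<in> S" "y \<in> S" "x \<le> y"
  have "\<exists>l. ((\<lambda>z. f z / z) has_real_derivative l) (at z) \<and> l \<le> 0" if "x \<le> z" "z \<le> y" for z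
    using mem_is_interval_1_I[OF S(1) xy(1,2) that] le[of z]
    by (intro exI[of _ "(z * f' z - f z) / z\<^sup>2"] conjI deriv_divide_self) (auto intro: divide_nonpos_nonneg)
  then show "f y / y \<le> f x / x"
    using DERIV_nonpos_imp_nonincreasing[OF xy(3)] by blast
qed

end

section \<open>The generalized inverse functions\<close>

lemma arsinh_pq_deriv:
  assumes "q > 0" "x > 0"
  shows "(arsinh_pq p q has_real_derivative (1 + x powr q) powr (- (1 / p))) (at x)"
proof -
  let ?g = "\<lambda>t. (1 + t powr q) powr (- (1 / p))"
  have "1 + t powr q \<noteq> 0" for t
    using powr_ge_zero[of t q] by linarith
  \<comment> \<open>The right end 2x puts x in the interior, so the derivative within the interval
    is the two-sided one.\<close>
  then have "continuous_on {0..2 * x} ?g"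
    using assms by (intro continuous_intros continuous_on_powr') auto
  then have "((\<lambda>x. integral {0..x} ?g) has_real_derivative ?g x) (at x within {0..2 * x})"
    using assms by (intro integral_has_real_derivative) auto
  moreover have "at x within {0..2 * x} = at x"
    using assms by (intro at_within_interior) auto
  ultimately show ?thesis
    by (simp add: arsinh_pq_def[abs_def])
qed

lemma arsinh_pq_pos:
  assumes "p > 0" "q > 0" "x > 0"
  shows "arsinh_pq p q x > 0"
proof -
  let ?g = "\<lambda>t. (1 + t powr q) powr (- (1 / p))"
  have pos: "1 + t powr q > 0" for t
    using powr_ge_zero[of t q] by linarith
  \<comment> \<open>The integrand decreases, so the integral is at least the length x times the
    value at the right end.\<close>
  have "0 < x * ?g x"
    using pos[of x] assms by simp
  also have "\<dots> = integral {0..x} (\<lambda>t. ?g x)"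
    using assms by simp
  also have "\<dots> \<le> integral {0..x} ?g"
  proof (rule integral_le)
    show "?g integrable_on {0..x}"
      using assms pos by (intro integrable_continuous_interval continuous_intros continuous_on_powr')
        (auto simp: less_imp_neq[symmetric])
    show "?g x \<le> ?g t" if "t \<in> {0..x}" for t
      using that assms pos by (intro powr_mono2' add_mono powr_mono2) auto
  qed auto
  finally show ?thesis
    by (simp add: arsinh_pq_def)
qed

lemma arsinh_pq_mean_concave:
  assumes "p > 0" "q > 0" "a \<ge> 1"
  shows "mean_concave_on a a {0<..} (arsinh_pq p q)"
proof -
  interpret mean_setting a "{0<..}" "arsinh_pq p q" "\<lambda>x. (1 + x powr q) powr (- (1 / p))"
    by unfold_locales (use assms arsinh_pq_deriv arsinh_pq_pos in \<open>auto simp: is_interval_1\<close>)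
  show ?thesis
  proof (rule mean_concaveI)
    show "antimono_on {0<..} (\<lambda>x. (1 + x powr q) powr (- (1 / p)))"
      using assms by (intro monotone_onI powr_mono2' add_mono powr_mono2) (auto intro: add_pos_nonneg)
  qed auto
qed

section \<open>The generalized arcsine\<close>

locale pq =
  fixes p q :: real
  assumes p: "p > 1" and q: "q > 1"
begin

text \<open>The integrand of \<open>arcsin_pq\<close>. For 0 < s < 1 its reciprocal at s is the
  cosine at \<open>arcsin_pq p q s\<close>, which is why it reappears in the tangent.\<close>

abbreviation w :: "real \<Rightarrow> real" where
  "w t \<equiv> (1 - t powr q) powr (- (1 / p))"

lemma powr_q_less_1: "0 \<le> t \<Longrightarrow> t < 1 \<Longrightarrow> t powr q < 1"
  using powr_less_mono2[of q t 1] q by auto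

text \<open>On [0, 1] one has t^q <= t, hence w t <= (1 - t)^(-1/p). This majorant has the primitive
  \<open>F\<close>, which is continuous up to the singular end t = 1 because p > 1 makes r = 1 - 1/p
  positive.\<close>

lemma w_integrable: "w integrable_on {0..1}"
proof (rule measurable_bounded_by_integrable_imp_integrable)
  show "w \<in> borel_measurable (lebesgue_on {0..1})"
    by (intro measurable_restrict_space1 measurable_completion) measurable
  define r where "r = 1 - 1 / p"
  have r: "r > 0"
    using p by (simp add: r_def)
  define F where "F = (\<lambda>t. - ((1 - t) powr r) / r)"
  \<comment> \<open>\<open>F\<close> is not differentiable at 1 since r < 1, so the fundamental
    theorem is used with differentiability in the interior only.\<close>
  have "((\<lambda>t. (1 - t) powr (- (1 / p))) has_integral (F 1 - F 0)) {0..1}"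
  proof (rule fundamental_theorem_of_calculus_interior)
    show "continuous_on {0..1} F"
      unfolding F_def using r by (intro continuous_intros continuous_on_powr') auto
    fix x :: real assume "x \<in> {0<..<1}"
    then have "((\<lambda>t. (1 - t) powr r) has_real_derivative r * (1 - x) powr (r - 1) * (- 1)) (at x)"
      using DERIV_fun_powr[of "\<lambda>t. 1 - t" "- 1" x r] by (auto intro!: derivative_eq_intros)
    from DERIV_cdivide[OF DERIV_minus[OF this], of r]
    show "(F has_vector_derivative (1 - x) powr (- (1 / p))) (at x)"
      unfolding F_def has_real_derivative_iff_has_vector_derivative[symmetric]
      using r p by (simp add: r_def)
  qed simp
  then show "(\<lambda>t. (1 - t) powr (- (1 / p))) integrable_on {0..1}"
    by blast
  fix t :: real assume t: "t \<in> {0..1}"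
  show "norm (w t) \<le> (1 - t) powr (- (1 / p))"
  \<comment> \<open>At t = 1 both sides are powers of 0, hence 0 by convention; antitonicity of the
    negative power needs a positive base.\<close>
  proof (cases "t = 1")
    case False
    have "t powr q \<le> t powr 1"
      using t q powr_mono'[of 1 q t] by simp
    then show ?thesis
      using t p False by (auto intro!: powr_mono2')
  qed simp
qed simp

lemma arcsin_continuous: "continuous_on {0..1} (arcsin_pq p q)"
  unfolding arcsin_pq_def[abs_def] by (rule indefinite_integral_continuous_1[OF w_integrable])

lemma arcsin_0 [simp]: "arcsin_pq p q 0 = 0"
  by (simp add: arcsin_pq_def)

lemma arcsin_deriv:
  assumes "0 < x" "x < 1"
  shows "(arcsin_pq p q has_real_derivative w x) (at x)"
proof -
  \<comment> \<open>A point strictly between x and 1: the integrand is continuous on [0, b], and x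
    is interior to it.\<close>
  define b where "b = (x + 1) / 2"
  have b: "x < b" "b < 1"
    using assms by (auto simp: b_def)
  have "1 - t powr q \<noteq> 0" if "t \<in> {0..b}" for t
    using powr_q_less_1[of t] that b by auto
  then have "continuous_on {0..b} w"
    using q by (intro continuous_intros continuous_on_powr') auto
  then have "((\<lambda>x. integral {0..x} w) has_real_derivative w x) (at x within {0..b})"
    using assms b by (intro integral_has_real_derivative) auto
  moreover have "at x within {0..b} = at x"
    using assms b by (intro at_within_interior) auto
  ultimately show ?thesis
    by (simp add: arcsin_pq_def[abs_def])
qed

lemma w_pos: "0 \<le> x \<Longrightarrow> x < 1 \<Longrightarrow> w x > 0"
  using powr_q_less_1[of x] by auto

lemma w_mono: "0 \<le> x \<Longrightarrow> x \<le> y \<Longrightarrow> y < 1 \<Longrightarrow> w x \<le> w y"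
  using p q powr_q_less_1[of y] by (intro powr_mono2') (auto intro!: powr_mono2)

lemma arcsin_MVT:
  assumes "0 \<le> x" "x < y" "y \<le> 1"
  obtains z where "x < z" "z < y" "arcsin_pq p q y - arcsin_pq p q x = (y - x) * w z"
proof -
  have cont: "continuous_on {x..y} (arcsin_pq p q)"
    using arcsin_continuous by (rule continuous_on_subset) (use assms in auto)
  have diff: "arcsin_pq p q differentiable (at z)" if "x < z" "z < y" for z
    using arcsin_deriv[of z] that assms by (auto simp: real_differentiable_def)
  obtain l z where z: "x < z" "z < y" "(arcsin_pq p q has_real_derivative l) (at z)"
    "arcsin_pq p q y - arcsin_pq p q x = (y - x) * l"
    using MVT[OF assms(2) cont diff] by blast
  then have "l = w z"
    using DERIV_unique arcsin_deriv[of z] assms by auto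
  with z that show thesis by blast
qed

lemma arcsin_strict_mono:
  assumes "0 \<le> x" "x < y" "y \<le> 1"
  shows "arcsin_pq p q x < arcsin_pq p q y"
proof -
  obtain z where z: "x < z" "z < y" "arcsin_pq p q y - arcsin_pq p q x = (y - x) * w z"
    using arcsin_MVT[OF assms] .
  then have "(y - x) * w z > 0"
    using w_pos[of z] assms by (intro mult_pos_pos) auto
  with z show ?thesis by simp
qed

lemma arcsin_pos: "0 < x \<Longrightarrow> x \<le> 1 \<Longrightarrow> arcsin_pq p q x > 0"
  using arcsin_strict_mono[of 0 x] by simp

lemma arcsin_inj: "inj_on (arcsin_pq p q) {0..1}"
  by (rule linorder_inj_onI) (use arcsin_strict_mono in \<open>force+\<close>)

lemma arcsin_mean_convex:
  assumes "a \<ge> 1"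
  shows "mean_convex_on a a {0<..<1} (arcsin_pq p q)"
proof -
  interpret mean_setting a "{0<..<1}" "arcsin_pq p q" w
    by unfold_locales (use assms arcsin_deriv arcsin_pos in \<open>auto simp: is_interval_1\<close>)
  show ?thesis
  proof (rule mean_convexI)
    fix x :: real assume x: "x \<in> {0<..<1}"
    \<comment> \<open>Since \<open>arcsin_pq\<close> vanishes at 0, the mean value theorem on [0, x]
      gives its value as x times an earlier, hence smaller, value of \<open>w\<close>.\<close>
    then obtain z where "0 < z" "z < x" "arcsin_pq p q x = x * w z"
      using arcsin_MVT[of 0 x] by auto
    then show "arcsin_pq p q x \<le> x * w x"
      using x w_mono[of z x] by auto
  qed (auto intro!: mono_onI w_mono)
qed

lemma arcsin_surj:
  assumes "y \<in> {0<..<pi_pq p q / 2}"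
  obtains s where "0 < s" "s < 1" "arcsin_pq p q s = y"
proof -
  have "\<exists>s\<ge>0. s \<le> 1 \<and> arcsin_pq p q s = y"
    using assms arcsin_continuous by (intro IVT') (auto simp: pi_pq_def)
  then obtain s where "0 \<le> s" "s \<le> 1" "arcsin_pq p q s = y" by blast
  moreover have "s \<noteq> 0" "s \<noteq> 1"
    using calculation assms by (auto simp: pi_pq_def)
  ultimately show thesis using that[of s] by simp
qed

lemma arcsin_range: "0 < s \<Longrightarrow> s < 1 \<Longrightarrow> arcsin_pq p q s \<in> {0<..<pi_pq p q / 2}"
  using arcsin_strict_mono[of s 1] arcsin_pos[of s] by (auto simp: pi_pq_def)

section \<open>Sine, cosine and tangent in the variable s = sin\<close>

lemma sin_arcsin:
  assumes "0 < s" "s < 1"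
  shows "sin_pq p q (arcsin_pq p q s) = s"
  unfolding sin_pq_def
  by (rule the_inv_into_f_f) (use assms arcsin_inj in \<open>auto elim: inj_on_subset\<close>)

lemma complement_bounds:
  fixes x u v :: real
  assumes "0 < x" "x < 1" "u > 0" "v > 0"
  shows "0 < (1 - x powr u) powr v" "(1 - x powr u) powr v < 1"
proof -
  have "0 < x powr u" "x powr u < 1"
    using powr_less_mono2[of u x 1] assms by auto
  then show "0 < (1 - x powr u) powr v" "(1 - x powr u) powr v < 1"
    using powr_less_mono2[of v "1 - x powr u" 1] assms by auto
qed

text \<open>On the curve x^u + y^v = 1 one solves for y and then again for x. Used with (u, v) = (p,
  q) for injectivity of \<open>arccos_pq\<close> and with (q, p) for its value at the
  cosine.\<close>

lemma complement_complement:
  fixes x u v :: real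
  assumes "0 < x" "x < 1" "u > 0" "v > 0"
  shows "(1 - ((1 - x powr u) powr (1 / v)) powr v) powr (1 / u) = x"
proof -
  have "x powr u < 1"
    using powr_less_mono2[of u x 1] assms by auto
  then show ?thesis
    using assms by (simp add: powr_powr)
qed

text \<open>The generalized Pythagorean identity sin^q + cos^p = 1, solved for the cosine. As
  \<open>arccos_pq\<close> is \<open>arcsin_pq\<close> after an injective substitution, its inverse
  is determined by exhibiting a preimage.\<close>

lemma cos_arcsin:
  assumes "0 < s" "s < 1"
  shows "cos_pq p q (arcsin_pq p q s) = (1 - s powr q) powr (1 / p)"
  unfolding cos_pq_def
proof (rule the_inv_into_f_eq)
  show "inj_on (arccos_pq p q) {0<..<1}"
  proof (rule inj_onI)
    fix x y assume xy: "x \<in> {0<..<1}" "y \<in> {0<..<1}" "arccos_pq p q x = arccos_pq p q y"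
    have *: "(1 - z powr p) powr (1 / q) \<in> {0..1}" if "z \<in> {0<..<1}" for z
      using p q complement_bounds[of z p "1 / q"] that by simp
    have "(1 - x powr p) powr (1 / q) = (1 - y powr p) powr (1 / q)"
      using inj_onD[OF arcsin_inj xy(3)[unfolded arccos_pq_def] *[OF xy(1)] *[OF xy(2)]] .
    then have "(1 - ((1 - x powr p) powr (1 / q)) powr q) powr (1 / p) =
        (1 - ((1 - y powr p) powr (1 / q)) powr q) powr (1 / p)"
      by (simp only:)
    then show "x = y"
      using complement_complement[of x p q] complement_complement[of y p q] xy p q by simp
  qed
  show "arccos_pq p q ((1 - s powr q) powr (1 / p)) = arcsin_pq p q s"
    using complement_complement[of s q p] assms p q by (simp add: arccos_pq_def)
  show "(1 - s powr q) powr (1 / p) \<in> {0<..<1}"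
    using complement_bounds[of s q "1 / p"] assms p q by simp
qed

text \<open>The tangent expressed in the variable \<open>s = sin_pq p q y\<close>, so that
  \<open>arctan_pq\<close> becomes \<open>arcsin_pq\<close> composed with its inverse.\<close>

definition tan_of_sin :: "real \<Rightarrow> real" where
  "tan_of_sin s = s * w s"

lemma tan_arcsin: "0 < s \<Longrightarrow> s < 1 \<Longrightarrow> tan_pq p q (arcsin_pq p q s) = tan_of_sin s"
  by (simp add: tan_pq_def sin_arcsin cos_arcsin tan_of_sin_def powr_minus field_simps)

lemma tan_of_sin_strict_mono: "0 < s \<Longrightarrow> s < t \<Longrightarrow> t < 1 \<Longrightarrow> tan_of_sin s < tan_of_sin t"
  using w_mono[of s t] w_pos[of s] unfolding tan_of_sin_def by (intro mult_less_le_imp_less) auto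

lemma tan_of_sin_inj: "inj_on tan_of_sin {0<..<1}"
  by (rule linorder_inj_onI) (use tan_of_sin_strict_mono in \<open>force+\<close>)

lemma tan_of_sin_surj:
  assumes "T > 0"
  obtains s where "0 < s" "s < 1" "tan_of_sin s = T"
proof -
  \<comment> \<open>\<open>tan_of_sin\<close> blows up at 1, so the equation
    \<open>tan_of_sin s = T\<close> is multiplied by the cosine. The resulting \<open>h\<close> is
    continuous on [0, 1] with h 0 = -T < 0 and h 1 = 1 > 0.\<close>
  define h where "h = (\<lambda>s. s - T * (1 - s powr q) powr (1 / p))"
  have "continuous_on {0..1} h"
    unfolding h_def using p q
    by (intro continuous_intros continuous_on_powr') (auto intro!: powr_le1)
  then have "\<exists>s\<ge>0. s \<le> 1 \<and> h s = 0"
    using assms by (intro IVT') (auto simp: h_def)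
  then obtain s where s: "0 \<le> s" "s \<le> 1" "h s = 0" by blast
  moreover have "s \<noteq> 0" "s \<noteq> 1"
    using s assms by (auto simp: h_def)
  moreover have "tan_of_sin s = T"
  proof -
    have "(1 - s powr q) powr (1 / p) > 0"
      using calculation powr_q_less_1[of s] by auto
    moreover have "tan_of_sin s = s / (1 - s powr q) powr (1 / p)" "s = T * (1 - s powr q) powr (1 / p)"
      using s by (simp_all add: h_def tan_of_sin_def powr_minus divide_inverse)
    ultimately show ?thesis
      by (metis less_irrefl nonzero_mult_div_cancel_right)
  qed
  ultimately show thesis using that[of s] by simp
qed

section \<open>The arctangent and its derivative\<close>

definition sin_of_tan :: "real \<Rightarrow> real" where
  "sin_of_tan = the_inv_into {0<..<1} tan_of_sin"

lemma sin_of_tan_tan_of_sin: "0 < s \<Longrightarrow> s < 1 \<Longrightarrow> sin_of_tan (tan_of_sin s) = s"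
  unfolding sin_of_tan_def by (rule the_inv_into_f_f[OF tan_of_sin_inj]) auto

lemma sin_of_tan:
  assumes "T > 0"
  shows "0 < sin_of_tan T" "sin_of_tan T < 1" "tan_of_sin (sin_of_tan T) = T"
  using tan_of_sin_surj[OF assms] sin_of_tan_tan_of_sin by metis+

lemma sin_of_tan_mono:
  assumes "0 < T" "T \<le> U"
  shows "sin_of_tan T \<le> sin_of_tan U"
  using tan_of_sin_strict_mono[of "sin_of_tan U" "sin_of_tan T"] sin_of_tan[of T] sin_of_tan[of U] assms by force

text \<open>Each point of the domain of \<open>tan_pq\<close> is some
  \<open>arcsin_pq p q s\<close>, where the tangent is \<open>tan_of_sin s\<close>. Injectivity of
  \<open>tan_pq\<close> thus reduces to that of \<open>tan_of_sin\<close>, and the right-hand side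
  is a preimage of T.\<close>

lemma arctan_eq:
  assumes "T > 0"
  shows "arctan_pq p q T = arcsin_pq p q (sin_of_tan T)"
  unfolding arctan_pq_def
proof (rule the_inv_into_f_eq)
  show "inj_on (tan_pq p q) {0<..<pi_pq p q / 2}"
  proof (rule inj_onI)
    fix y z assume "y \<in> {0<..<pi_pq p q / 2}" "z \<in> {0<..<pi_pq p q / 2}"
      and eq: "tan_pq p q y = tan_pq p q z"
    then obtain s t where "0 < s" "s < 1" "arcsin_pq p q s = y" "0 < t" "t < 1" "arcsin_pq p q t = z"
      using arcsin_surj by metis
    then show "y = z"
      using eq tan_arcsin sin_of_tan_tan_of_sin by metis
  qed
qed (use sin_of_tan[OF assms] tan_arcsin arcsin_range in auto)

text \<open>The derivative of \<open>tan_pq p q\<close> at \<open>arcsin_pq p q s\<close>.\<close>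

definition tan_slope :: "real \<Rightarrow> real" where
  "tan_slope s = 1 + q / p * (s powr q / (1 - s powr q))"

lemma tan_slope_pos: "0 < s \<Longrightarrow> s < 1 \<Longrightarrow> tan_slope s > 0"
  using powr_q_less_1[of s] p q unfolding tan_slope_def
  by (intro add_pos_nonneg mult_nonneg_nonneg divide_nonneg_nonneg) auto

lemma tan_slope_mono:
  assumes "0 < s" "s \<le> t" "t < 1"
  shows "tan_slope s \<le> tan_slope t"
proof -
  have "s powr q \<le> t powr q" "t powr q < 1"
    using assms q powr_q_less_1[of t] by (auto intro!: powr_mono2)
  then show ?thesis
    unfolding tan_slope_def using p q
    by (intro add_mono mult_left_mono frac_le) auto
qed

text \<open>The factor \<open>w s\<close> is the derivative of \<open>arcsin_pq\<close> at s.
  Splitting it off leaves the slope of the tangent in the original variable, and it cancels in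
  \<open>arctan_deriv\<close>.\<close>

lemma tan_of_sin_deriv:
  assumes "0 < s" "s < 1"
  shows "(tan_of_sin has_real_derivative w s * tan_slope s) (at s)"
proof -
  define c where "c = 1 - s powr q"
  have c: "c > 0"
    using powr_q_less_1[of s] assms by (simp add: c_def)
  have "((\<lambda>s. 1 - s powr q) has_real_derivative - (q * s powr (q - 1))) (at s)"
    using DERIV_diff[OF DERIV_const has_real_derivative_powr[OF assms(1), of q], of 1] by simp
  then have "(w has_real_derivative - (1 / p) * c powr (- (1 / p) - 1) * - (q * s powr (q - 1))) (at s)"
    using DERIV_fun_powr[of "\<lambda>s. 1 - s powr q" "- (q * s powr (q - 1))" s "- (1 / p)"] c
    unfolding c_def by simp
  from DERIV_mult[OF DERIV_ident this]
  have "((\<lambda>s. s * w s) has_real_derivative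
      w s + s * (- (1 / p) * c powr (- (1 / p) - 1) * - (q * s powr (q - 1)))) (at s)"
    by (simp add: algebra_simps)
  moreover have "w s + s * (- (1 / p) * c powr (- (1 / p) - 1) * - (q * s powr (q - 1))) = w s * tan_slope s"
  proof -
    have eqs: "c powr (- (1 / p) - 1) = w s / c" "s powr (q - 1) = s powr q / s"
      using c assms by (simp_all add: powr_diff c_def)
    then show ?thesis
      unfolding eqs tan_slope_def c_def[symmetric] using c assms p by (simp add: field_simps)
  qed
  ultimately show ?thesis
    by (simp add: tan_of_sin_def[abs_def])
qed

lemma sin_of_tan_deriv:
  assumes "T > 0"
  shows "(sin_of_tan has_real_derivative inverse (w (sin_of_tan T) * tan_slope (sin_of_tan T))) (at T)"
proof -
  define s where "s = sin_of_tan T"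
  have s: "0 < s" "s < 1" "tan_of_sin s = T"
    using sin_of_tan[OF assms] by (auto simp: s_def)
  have pos: "w s * tan_slope s > 0"
    using w_pos[of s] tan_slope_pos[of s] s by auto
  \<comment> \<open>The inverse function theorem at the point s of the open interval (0, 1), with
    derivatives read as multiplication maps.\<close>
  have "(sin_of_tan has_derivative (*) (inverse (w s * tan_slope s))) (at (tan_of_sin s))"
  proof (rule has_derivative_inverse_strong[where S = "{0<..<1}" and f = tan_of_sin and x = s and f' = "(*) (w s * tan_slope s)"])
    show "continuous_on {0<..<1} tan_of_sin"
      by (intro continuous_at_imp_continuous_on ballI DERIV_isCont[OF tan_of_sin_deriv]) auto
    show "(tan_of_sin has_derivative (*) (w s * tan_slope s)) (at s)"
      using tan_of_sin_deriv[of s] s by (simp add: has_field_derivative_def)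
    show "(*) (w s * tan_slope s) \<circ> (*) (inverse (w s * tan_slope s)) = id"
      using pos by (auto simp: fun_eq_iff field_simps)
  qed (use s sin_of_tan_tan_of_sin in auto)
  then show ?thesis
    using s by (simp add: has_field_derivative_def s_def)
qed

lemma arctan_deriv:
  assumes "T > 0"
  shows "(arctan_pq p q has_real_derivative inverse (tan_slope (sin_of_tan T))) (at T)"
proof -
  have s: "0 < sin_of_tan T" "sin_of_tan T < 1"
    using sin_of_tan[OF assms] by auto
  have "((\<lambda>T. arcsin_pq p q (sin_of_tan T)) has_real_derivative
      w (sin_of_tan T) * inverse (w (sin_of_tan T) * tan_slope (sin_of_tan T))) (at T)"
    by (rule DERIV_chain2[OF arcsin_deriv[OF s] sin_of_tan_deriv[OF assms]])
  moreover have "w (sin_of_tan T) * inverse (w (sin_of_tan T) * tan_slope (sin_of_tan T)) = inverse (tan_slope (sin_of_tan T))"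
    using w_pos[of "sin_of_tan T"] s by simp
  ultimately have D: "((\<lambda>T. arcsin_pq p q (sin_of_tan T)) has_real_derivative inverse (tan_slope (sin_of_tan T))) (at T)"
    by (simp only:)
  \<comment> \<open>The formula for \<open>arctan_pq\<close> is known only for positive arguments,
    so the derivative is transferred along equality in a neighbourhood of T.\<close>
  have "\<forall>\<^sub>F T in nhds T. arctan_pq p q T = arcsin_pq p q (sin_of_tan T)"
    using eventually_nhds_in_open[of "{0<..}" T] assms
    by (auto elim!: eventually_mono simp: arctan_eq)
  then show ?thesis
    using D DERIV_cong_ev[OF refl _ refl, of "arctan_pq p q" "\<lambda>T. arcsin_pq p q (sin_of_tan T)"] by simp
qed

lemma arctan_mean_concave:
  assumes "a \<ge> 1"
  shows "mean_concave_on a a {0<..<1} (arctan_pq p q)"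
proof -
  interpret mean_setting a "{0<..<1}" "arctan_pq p q" "\<lambda>T. inverse (tan_slope (sin_of_tan T))"
    by unfold_locales
      (use assms arctan_deriv arcsin_pos sin_of_tan tan_slope_pos in
        \<open>auto simp: is_interval_1 arctan_eq less_imp_le\<close>)
  show ?thesis
  proof (rule mean_concaveI)
    show "antimono_on {0<..<1} (\<lambda>T. inverse (tan_slope (sin_of_tan T)))"
      using sin_of_tan sin_of_tan_mono tan_slope_pos tan_slope_mono
      by (intro monotone_onI le_imp_inverse_le) auto
  qed auto
qed

end

theorem theorem1:
  fixes p q a :: real
  assumes "p > 1" and "q > 1" and "a \<ge> 1"
  shows "mean_convex_on a a {0<..<1} (arcsin_pq p q)
       \<and> mean_concave_on a a {0<..<1} (arctan_pq p q)
       \<and> mean_concave_on a a {0<..} (arsinh_pq p q)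
       \<and> (\<forall>r\<in>{0<..<1}. \<forall>s\<in>{0<..<1}.
            arcsin_pq p q (power_mean a r s) \<le> power_mean a (arcsin_pq p q r) (arcsin_pq p q s))
       \<and> (\<forall>r\<in>{0<..<1}. \<forall>s\<in>{0<..<1}.
            arctan_pq p q (power_mean a r s) \<ge> power_mean a (arctan_pq p q r) (arctan_pq p q s))
       \<and> (\<forall>r>0. \<forall>s>0.
            arsinh_pq p q (power_mean a r s) \<ge> power_mean a (arsinh_pq p q r) (arsinh_pq p q s))"
proof -
  interpret pq p q
    by unfold_locales (use assms in auto)
  have "mean_convex_on a a {0<..<1} (arcsin_pq p q)" "mean_concave_on a a {0<..<1} (arctan_pq p q)"
    "mean_concave_on a a {0<..} (arsinh_pq p q)"
    using assms arcsin_mean_convex arctan_mean_concave arsinh_pq_mean_concave by auto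
  then show ?thesis
    by (simp add: mean_convex_on_def mean_concave_on_def)
qed

end
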